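(* Let $h(u_1,\dots,u_5)=d\det\begin{pmatrix} u_1 & u_2 & u_3 \\ u_2 & u_3 & u_4 \\ u_3 & u_4 & u_5 \end{pmatrix}+a_1(u_1u_3-u_2^2)+\cdots+b_1u_1+\cdots+c$ be a linear combination with constant coefficients of the minors of all orders of the displayed matrix, with $d\neq0$. The system of conservation laws defined by $h(u_1,\dots,u_5)=0$ and $$(u_1)_t=(u_2)_x,\quad (u_2)_t=(u_3)_x,\quad (u_3)_t=(u_4)_x,\quad (u_4)_t=(u_5)_x$$ is a non linearizable $T$-system, i.e. (it is a $T$-system and) the corresponding congruence of lines in $\mathbb{P}^5$ is not contained in a linear congruence.
   Context: Linear combination of the minors of all orders means: coefficient $d$ for the determinant, $a_1,\dots,a_6$ for the distinct $2\times2$ minors, $b_1,\dots,b_5$ for the entries, and constant term $c$. Via $h=0$ one regards $u_5=g(u_1,\dots,u_4)$ locally, so that the equations form a system of conservation laws in the four unknowns $u_1,\dots,u_4$. For a strictly hyperbolic system of conservation laws $(u_i)_t=(f_i(u))_x$, the rarefaction curves are the integral curves of the eigenvector fields of the Jacobian matrix $(\partial f_i/\partial u_j)$. The system is linearly degenerate if the eigenvalues of the Jacobian matrix are constant along the rarefaction curves. A linearly degenerate system is of Temple class, or a $T$-system, if moreover the rarefaction curves are lines. Equivalently (Agafonov-Ferapontov), a $T$-system is characterized by the following property of the corresponding congruence of lines: each focus is a fundamental point (a point through which infinitely many lines of the congruence pass), and the lines of the congruence through a general focal point form a planar pencil. The congruence of lines corresponding to the given system is the (closure of the) family of lines in $\mathbb{P}^5$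 with affine coordinates $(y_0,\dots,y_4)$ given by $y_i=u_iy_0-u_{i+1}$, $i=1,\dots,4$, with $(u_1,\dots,u_5)$ satisfying $h=0$. A linear congruence in $\mathbb{P}^5$ is a $4$-dimensional section of the Grassmannian $\mathbb{G}(1,5)\subset\mathbb{P}^{14}$ by a linear space of dimension $10$. A focus (focal point) is a point of the focal locus, the image of the ramification divisor of the projection to $\mathbb{P}^5$ from the incidence variety of pairs (line of the congruence, point on it).
   Formalization: The T-system claim is made on open sets where h=0 gives u_5=g(u_1,...,u_4) and the system is strictly hyperbolic; strict hyperbolicity is assumed, since it can fail (for h=det the characteristic polynomial is always a square). Non-linearizability is unconditional. *)

theory Defs
  imports "HOL-Analysis.Analysis"
begin

section \<open>Systems of conservation laws\<close>

text \<open>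
  The scalars range over a type of class \<open>{real_normed_field, euclidean_space}\<close>. By the
  Gelfand--Mazur theorem the only such fields are the reals and the complex numbers, so a statement
  that is polymorphic in the scalars covers the real (hyperbolic) case and its holomorphic
  counterpart. A system \<open>(u\<^sub>i)\<^sub>t = (f\<^sub>i(u))\<^sub>x\<close> is given by its flux \<open>f\<close> and the open set \<open>U\<close> of
  admissible values of \<open>u\<close>.
\<close>

definition jacobian_matrix :: "('a::real_normed_field ^ 'n \<Rightarrow> 'a ^ 'n) \<Rightarrow> 'a ^ 'n \<Rightarrow> 'a ^ 'n ^ 'n"
  where "jacobian_matrix f u = (\<chi> i j. deriv (\<lambda>t. f (u + t *s axis j 1) $ i) 0)"

definition eigenvalues :: "'a::field ^ 'n ^ 'n \<Rightarrow> 'a set"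
  where "eigenvalues A = {l. \<exists>r. r \<noteq> 0 \<and> A *v r = l *s r}"

definition strictly_hyperbolic ::
    "('a::real_normed_field ^ 'n) set \<Rightarrow> ('a ^ 'n \<Rightarrow> 'a ^ 'n) \<Rightarrow> bool"
  where "strictly_hyperbolic U f \<longleftrightarrow>
    (\<forall>u\<in>U. card (eigenvalues (jacobian_matrix f u)) = CARD('n))"

text \<open>
  \<open>r\<close> is a field of eigenvectors on \<open>V\<close> with eigenvalue function \<open>l\<close>. Such fields need only exist
  locally, hence \<open>V\<close> will be an arbitrary open part of \<open>U\<close>.
\<close>

definition eigenvector_field ::
    "('a::real_normed_field ^ 'n \<Rightarrow> 'a ^ 'n) \<Rightarrow> ('a ^ 'n) set \<Rightarrow> ('a ^ 'n \<Rightarrow> 'a) \<Rightarrow> ('a ^ 'n \<Rightarrow> 'a ^ 'n) \<Rightarrow> bool"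
  where "eigenvector_field f V l r \<longleftrightarrow>
    open V \<and> continuous_on V r \<and>
    (\<forall>u\<in>V. r u \<noteq> 0 \<and> jacobian_matrix f u *v r u = l u *s r u)"

text \<open>Over the reals the parameter domain \<open>S\<close> is an open interval.\<close>

definition integral_curve ::
    "('a::real_normed_field ^ 'n \<Rightarrow> 'a ^ 'n) \<Rightarrow> ('a ^ 'n) set \<Rightarrow> 'a set \<Rightarrow> ('a \<Rightarrow> 'a ^ 'n) \<Rightarrow> bool"
  where "integral_curve r V S \<gamma> \<longleftrightarrow>
    open S \<and> connected S \<and>
    (\<forall>t\<in>S. \<gamma> t \<in> V \<and> (\<forall>i. ((\<lambda>s. \<gamma> s $ i) has_field_derivative r (\<gamma> t) $ i) (at t)))"

text \<open>\<open>\<gamma>\<close>, defined on \<open>S\<close>, is a rarefaction curve in \<open>U\<close> belonging to the eigenvalue function \<open>l\<close>.\<close>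

definition rarefaction_curve ::
    "('a::real_normed_field ^ 'n) set \<Rightarrow> ('a ^ 'n \<Rightarrow> 'a ^ 'n) \<Rightarrow> ('a ^ 'n \<Rightarrow> 'a) \<Rightarrow> 'a set \<Rightarrow> ('a \<Rightarrow> 'a ^ 'n) \<Rightarrow> bool"
  where "rarefaction_curve U f l S \<gamma> \<longleftrightarrow>
    (\<exists>V r. V \<subseteq> U \<and> eigenvector_field f V l r \<and> integral_curve r V S \<gamma>)"

definition linearly_degenerate ::
    "('a::real_normed_field ^ 'n) set \<Rightarrow> ('a ^ 'n \<Rightarrow> 'a ^ 'n) \<Rightarrow> bool"
  where "linearly_degenerate U f \<longleftrightarrow>
    (\<forall>l S \<gamma>. rarefaction_curve U f l S \<gamma> \<longrightarrow> (l \<circ> \<gamma>) constant_on S)"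

text \<open>As \<open>U\<close> need not be the whole space, a rarefaction curve may be just a piece of a line.\<close>

definition rarefaction_curves_are_lines ::
    "('a::real_normed_field ^ 'n) set \<Rightarrow> ('a ^ 'n \<Rightarrow> 'a ^ 'n) \<Rightarrow> bool"
  where "rarefaction_curves_are_lines U f \<longleftrightarrow>
    (\<forall>l S \<gamma>. rarefaction_curve U f l S \<gamma> \<longrightarrow>
      (\<exists>p v. v \<noteq> 0 \<and> \<gamma> ` S \<subseteq> range (\<lambda>t. p + t *s v)))"

definition T_system ::
    "('a::real_normed_field ^ 'n) set \<Rightarrow> ('a ^ 'n \<Rightarrow> 'a ^ 'n) \<Rightarrow> bool"
  where "T_system U f \<longleftrightarrow>
    open U \<and>
    (\<forall>u\<in>U. (f has_derivative (*v) (jacobian_matrix f u)) (at u)) \<and>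
    continuous_on U (jacobian_matrix f) \<and>
    strictly_hyperbolic U f \<and> linearly_degenerate U f \<and> rarefaction_curves_are_lines U f"


section \<open>The system defined by a combination of Hankel minors\<close>

definition hankel :: "'a::zero ^ 5 \<Rightarrow> 'a ^ 3 ^ 3"
  where "hankel u = vector [vector [u $ 1, u $ 2, u $ 3],
                            vector [u $ 2, u $ 3, u $ 4],
                            vector [u $ 3, u $ 4, u $ 5]]"

text \<open>The matrix is symmetric, so it has six distinct minors of size 2 and five distinct entries.\<close>

definition minor_combination ::
    "'a::field \<Rightarrow> 'a ^ 6 \<Rightarrow> 'a ^ 5 \<Rightarrow> 'a \<Rightarrow> 'a ^ 5 \<Rightarrow> 'a"
  where "minor_combination d a b c u =
    d * det (hankel u)
    + a $ 1 * (u $ 1 * u $ 3 - (u $ 2)\<^sup>2)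
    + a $ 2 * (u $ 1 * u $ 4 - u $ 2 * u $ 3)
    + a $ 3 * (u $ 1 * u $ 5 - (u $ 3)\<^sup>2)
    + a $ 4 * (u $ 2 * u $ 4 - (u $ 3)\<^sup>2)
    + a $ 5 * (u $ 2 * u $ 5 - u $ 3 * u $ 4)
    + a $ 6 * (u $ 3 * u $ 5 - (u $ 4)\<^sup>2)
    + b $ 1 * u $ 1 + b $ 2 * u $ 2 + b $ 3 * u $ 3 + b $ 4 * u $ 4 + b $ 5 * u $ 5
    + c"

definition append5 :: "'a::zero ^ 4 \<Rightarrow> 'a \<Rightarrow> 'a ^ 5"
  where "append5 u s = vector [u $ 1, u $ 2, u $ 3, u $ 4, s]"

text \<open>
  On \<open>U\<close> the equation \<open>h = 0\<close> is solved by \<open>u\<^sub>5 = g(u\<^sub>1,\<dots>,u\<^sub>4)\<close>, in the situation of the implicit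
  function theorem.
\<close>

definition solves_for_u5 ::
    "('a::real_normed_field ^ 5 \<Rightarrow> 'a) \<Rightarrow> ('a ^ 4) set \<Rightarrow> ('a ^ 4 \<Rightarrow> 'a) \<Rightarrow> bool"
  where "solves_for_u5 h U g \<longleftrightarrow>
    open U \<and> continuous_on U g \<and>
    (\<forall>u\<in>U. h (append5 u (g u)) = 0 \<and> deriv (\<lambda>s. h (append5 u s)) (g u) \<noteq> 0)"

definition shift_flux :: "('a::zero ^ 4 \<Rightarrow> 'a) \<Rightarrow> 'a ^ 4 \<Rightarrow> 'a ^ 4"
  where "shift_flux g u = vector [u $ 2, u $ 3, u $ 4, g u]"


section \<open>Lines in projective space\<close>

text \<open>
  A line in the projective space of \<open>'a ^ 'n\<close> is a two-dimensional subspace of \<open>'a ^ 'n\<close>. Its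
  Pluecker vectors are the bivectors \<open>x \<and> y\<close> with \<open>x\<close>, \<open>y\<close> in it; the exterior square of \<open>'a ^ 'n\<close>
  is represented by the skew-symmetric matrices, which for \<open>n = 6\<close> form a space of dimension 15.
\<close>

definition projective_lines :: "('a::field ^ 'n) set set"
  where "projective_lines = {L. vec.subspace L \<and> vec.dim L = 2}"

definition wedge :: "'a::field ^ 'n \<Rightarrow> 'a ^ 'n \<Rightarrow> 'a ^ ('n \<times> 'n)"
  where "wedge x y = (\<chi> p. x $ fst p * y $ snd p - x $ snd p * y $ fst p)"

definition bivectors :: "('a::field ^ ('n::finite \<times> 'n)) set"
  where "bivectors = {\<omega>. (\<forall>i. \<omega> $ (i, i) = 0) \<and> (\<forall>i j. \<omega> $ (i, j) = - \<omega> $ (j, i))}"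

inductive polynomial_map :: "('a::field ^ 'm \<Rightarrow> 'a) \<Rightarrow> bool"
  where
    const: "polynomial_map (\<lambda>x. c)"
  | coordinate: "polynomial_map (\<lambda>x. x $ i)"
  | add: "polynomial_map p \<Longrightarrow> polynomial_map q \<Longrightarrow> polynomial_map (\<lambda>x. p x + q x)"
  | mult: "polynomial_map p \<Longrightarrow> polynomial_map q \<Longrightarrow> polynomial_map (\<lambda>x. p x * q x)"

text \<open>
  The Zariski topology of the Grassmannian of lines in its Pluecker embedding. The Pluecker vectors
  of a line are all the multiples of a single one, so over an infinite field a polynomial vanishes
  on all of them iff its homogeneous components do. Hence it does no harm to allow inhomogeneous
  polynomials.
\<close>

definition zariski :: "('a::field ^ 'n) set topology"
  where "zariski = topology_generated_by
    {{L \<in> projective_lines. \<exists>x\<in>L. \<exists>y\<in>L. p (wedge x y) \<noteq> 0} | p. polynomial_map p}"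

definition irreducible_in :: "'b topology \<Rightarrow> 'b set \<Rightarrow> bool"
  where "irreducible_in T Z \<longleftrightarrow>
    Z \<noteq> {} \<and> Z \<subseteq> topspace T \<and>
    (\<forall>A B. closedin T A \<longrightarrow> closedin T B \<longrightarrow> Z \<subseteq> A \<union> B \<longrightarrow> Z \<subseteq> A \<or> Z \<subseteq> B)"

definition irreducible_chain :: "'b topology \<Rightarrow> 'b set \<Rightarrow> nat \<Rightarrow> (nat \<Rightarrow> 'b set) \<Rightarrow> bool"
  where "irreducible_chain T X n Z \<longleftrightarrow>
    (\<forall>i\<le>n. closedin T (Z i) \<and> irreducible_in T (Z i) \<and> Z i \<subseteq> X) \<and>
    (\<forall>i<n. Z i \<subset> Z (Suc i))"

text \<open>The dimension of a closed set \<open>X\<close>, as the maximal length of a chain of irreducible closed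
  subsets.\<close>

definition has_dimension :: "'b topology \<Rightarrow> 'b set \<Rightarrow> nat \<Rightarrow> bool"
  where "has_dimension T X n \<longleftrightarrow>
    (\<exists>Z. irreducible_chain T X n Z) \<and> (\<forall>m>n. \<nexists>Z. irreducible_chain T X m Z)"

definition linear_section :: "('a::field ^ ('n::finite \<times> 'n)) set \<Rightarrow> ('a ^ 'n) set set"
  where "linear_section \<Lambda> = {L \<in> projective_lines. \<forall>x\<in>L. \<forall>y\<in>L. wedge x y \<in> \<Lambda>}"

text \<open>A projective linear space of dimension 10 is a vector space \<open>\<Lambda>\<close> of dimension 11.\<close>

definition linear_congruence :: "('a::field ^ 6) set set \<Rightarrow> bool"
  where "linear_congruence X \<longleftrightarrow>
    (\<exists>\<Lambda>. vec.subspace \<Lambda> \<and> \<Lambda> \<subseteq> bivectors \<and> vec.dim \<Lambda> = 11 \<and> X = linear_section \<Lambda>) \<and>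
    has_dimension zariski X 4"

text \<open>
  \<open>Y $ 0, \<dots>, Y $ 5\<close> are the six coordinates (the indices are residues modulo 6); the affine chart
  with coordinates \<open>y\<^sub>i = Y\<^sub>i / Y\<^sub>5\<close>, \<open>i = 0, \<dots>, 4\<close>, is the complement of the hyperplane \<open>Y\<^sub>5 = 0\<close>.
\<close>

definition congruence_line :: "'a::field ^ 5 \<Rightarrow> ('a ^ 6) set"
  where "congruence_line u =
    {Y. Y $ 1 = u $ 1 * Y $ 0 - u $ 2 * Y $ 5 \<and>
        Y $ 2 = u $ 2 * Y $ 0 - u $ 3 * Y $ 5 \<and>
        Y $ 3 = u $ 3 * Y $ 0 - u $ 4 * Y $ 5 \<and>
        Y $ 4 = u $ 4 * Y $ 0 - u $ 5 * Y $ 5}"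

definition congruence_of_lines :: "('a::field ^ 5 \<Rightarrow> 'a) \<Rightarrow> ('a ^ 6) set set"
  where "congruence_of_lines h = zariski closure_of {congruence_line u | u. h u = 0}"

end

theory Submission
  imports Defs "HOL-Computational_Algebra.Polynomial"
begin

text \<open>
  Put \<open>r(l) = (1, l, l\<^sup>2, l\<^sup>3, l\<^sup>4)\<close>, whose Hankel matrix has rank one, and let \<open>h\<^sub>i\<close> be the partial
  derivatives of \<open>h\<close>. As \<open>h\<close> is affine in \<open>u\<^sub>5\<close>, the implicit function \<open>g\<close> is rational, with partial
  derivatives \<open>- h\<^sub>i / h\<^sub>5\<close>, and the Jacobian matrix of the flux is a companion matrix. Its
  eigenvalues are the roots of \<open>F(u, l) = \<Sum>\<^sub>i h\<^sub>i(u) l\<^bsup>i-1\<^esup>\<close>, the derivative of \<open>h\<close> in the direction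
  \<open>r(l)\<close>, and the eigenvectors are the multiples of \<open>(1, l, l\<^sup>2, l\<^sup>3)\<close>.

  All minors of a matrix are affine in the direction of a matrix of rank one, so
  \<open>F(u + t r(l), l) = F(u, l)\<close>. Along a rarefaction curve with eigenvalue \<open>l\<close>, the lifted point
  \<open>(u, g(u))\<close> moves in the direction \<open>r(l)\<close>; hence for the present value of \<open>l\<close> the derivative of
  \<open>F(\<cdot>, l)\<close> vanishes (\<open>characteristic_poly_along_curve\<close>). Strict hyperbolicity makes \<open>l\<close> a simple
  root, so its derivative vanishes too (\<open>DERIV_zero_of_factor\<close>). So \<open>l\<close> is constant, and with it
  the direction of the curve, which is therefore a piece of a line.

  For the second part, the Pluecker coordinates of the lines of the congruence span the same space
  of functions as \<open>1\<close>, the \<open>u\<^sub>i\<close> and the six minors of size 2. These 12 functions are linearly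
  independent on \<open>h = 0\<close>, because \<open>d \<noteq> 0\<close> makes \<open>h\<close> a cubic
  (\<open>hankel_minors_independent_on_hypersurface\<close>). Hence the Pluecker vectors span a space of dimension
  at least 12, whereas a linear congruence is a section by a space of vector dimension 11.
\<close>

section \<open>Coordinates\<close>

lemma vector_4 [simp]:
  "(vector [x1, x2, x3, x4] :: 'a::zero ^ 4) $ 1 = x1"
  "(vector [x1, x2, x3, x4] :: 'a::zero ^ 4) $ 2 = x2"
  "(vector [x1, x2, x3, x4] :: 'a::zero ^ 4) $ 3 = x3"
  "(vector [x1, x2, x3, x4] :: 'a::zero ^ 4) $ 4 = x4"
  unfolding vector_def by simp_all

lemma vector_5 [simp]:
  "(vector [x1, x2, x3, x4, x5] :: 'a::zero ^ 5) $ 1 = x1"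
  "(vector [x1, x2, x3, x4, x5] :: 'a::zero ^ 5) $ 2 = x2"
  "(vector [x1, x2, x3, x4, x5] :: 'a::zero ^ 5) $ 3 = x3"
  "(vector [x1, x2, x3, x4, x5] :: 'a::zero ^ 5) $ 4 = x4"
  "(vector [x1, x2, x3, x4, x5] :: 'a::zero ^ 5) $ 5 = x5"
  unfolding vector_def by simp_all

text \<open>The last component of a vector of length 6 has index 6, which is the residue 0.\<close>

lemma vector_6 [simp]:
  "(vector [x1, x2, x3, x4, x5, x6] :: 'a::zero ^ 6) $ 1 = x1"
  "(vector [x1, x2, x3, x4, x5, x6] :: 'a::zero ^ 6) $ 2 = x2"
  "(vector [x1, x2, x3, x4, x5, x6] :: 'a::zero ^ 6) $ 3 = x3"
  "(vector [x1, x2, x3, x4, x5, x6] :: 'a::zero ^ 6) $ 4 = x4"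
  "(vector [x1, x2, x3, x4, x5, x6] :: 'a::zero ^ 6) $ 5 = x5"
  "(vector [x1, x2, x3, x4, x5, x6] :: 'a::zero ^ 6) $ 6 = x6"
  "(vector [x1, x2, x3, x4, x5, x6] :: 'a::zero ^ 6) $ 0 = x6"
  unfolding vector_def by simp_all

lemma exhaust_5:
  fixes x :: 5
  shows "x = 1 \<or> x = 2 \<or> x = 3 \<or> x = 4 \<or> x = 5"
proof (induct x)
  case (of_int z)
  then have "z = 0 \<or> z = 1 \<or> z = 2 \<or> z = 3 \<or> z = 4" by fastforce
  then show ?case by auto
qed

lemma forall_5: "(\<forall>i::5. P i) \<longleftrightarrow> P 1 \<and> P 2 \<and> P 3 \<and> P 4 \<and> P 5"
  by (metis exhaust_5)

lemma exhaust_6: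
  fixes x :: 6
  shows "x = 0 \<or> x = 1 \<or> x = 2 \<or> x = 3 \<or> x = 4 \<or> x = 5"
proof (induct x)
  case (of_int z)
  then have "z = 0 \<or> z = 1 \<or> z = 2 \<or> z = 3 \<or> z = 4 \<or> z = 5" by fastforce
  then show ?case by auto
qed

lemma forall_6: "(\<forall>i::6. P i) \<longleftrightarrow> P 0 \<and> P 1 \<and> P 2 \<and> P 3 \<and> P 4 \<and> P 5"
  by (metis exhaust_6)

section \<open>Derivatives of vector-valued maps\<close>

lemma has_derivative_vec_nth [derivative_intros]:
  assumes "(f has_derivative f') F"
  shows "((\<lambda>x. f x $ i) has_derivative (\<lambda>v. f' v $ i)) F"
  by (rule bounded_linear.has_derivative[OF bounded_linear_vec_nth assms])

lemma has_derivative_vecI: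
  fixes f :: "'a::real_normed_vector \<Rightarrow> 'b::real_normed_vector ^ 'n"
  assumes "\<And>i. ((\<lambda>x. f x $ i) has_derivative (\<lambda>v. f' v $ i)) F"
  shows "(f has_derivative f') F"
proof -
  have bl: "bounded_linear (axis i :: 'b \<Rightarrow> 'b ^ 'n)" for i
    by (rule bounded_linear_intro[where K = 1])
      (auto simp: vec_eq_iff axis_def norm_vec_def L2_set_def if_distrib[where f = norm]
        if_distrib[where f = "\<lambda>x. x\<^sup>2"] cong: if_cong)
  have sum: "(\<Sum>i\<in>UNIV. axis i (x $ i)) = x" for x :: "'b ^ 'n"
    by (simp add: vec_eq_iff axis_def)
  have "((\<lambda>x. \<Sum>i\<in>UNIV. axis i (f x $ i)) has_derivative (\<lambda>v. \<Sum>i\<in>UNIV. axis i (f' v $ i))) F"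
    by (intro has_derivative_sum bounded_linear.has_derivative[OF bl] assms)
  then show ?thesis by (simp add: sum)
qed

lemma jacobian_matrix_eqI:
  assumes "(f has_derivative (*v) M) (at u)"
  shows "jacobian_matrix f u = M"
proof -
  have "deriv (\<lambda>t. f (u + t *s axis j 1) $ i) 0 = M $ i $ j" for i j
  proof (rule DERIV_imp_deriv)
    have "((\<lambda>t. u + t *s axis j 1) has_derivative (\<lambda>t. t *s axis j 1)) (at 0)"
      by (rule has_derivative_vecI) (auto intro!: derivative_eq_intros simp: mult.commute)
    from has_derivative_compose[OF this, of f "(*v) M"] assms
    have "((\<lambda>t. f (u + t *s axis j 1)) has_derivative (\<lambda>t. M *v (t *s axis j 1))) (at 0)"
      by simp
    from has_derivative_vec_nth[OF this, of i]
    have *: "((\<lambda>t. f (u + t *s axis j 1) $ i) has_derivative (\<lambda>t. (M *v (t *s axis j 1)) $ i)) (at 0)" .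
    have "(M *v (t *s axis j 1)) $ i = M $ i $ j * t" for t
    proof -
      have "t *s axis j 1 = axis j t" by (simp add: vec_eq_iff axis_def)
      then show ?thesis
        by (simp add: matrix_vector_mult_def axis_def if_distrib[where f = "(*) _"] cong: if_cong)
    qed
    with * show "((\<lambda>t. f (u + t *s axis j 1) $ i) has_field_derivative M $ i $ j) (at 0)"
      by (simp add: has_field_derivative_def)
  qed
  then show ?thesis by (simp add: jacobian_matrix_def vec_eq_iff)
qed

section \<open>The gradient of a combination of Hankel minors\<close>

text \<open>The partial derivatives of \<open>minor_combination d a b c\<close>, which do not involve \<open>c\<close>.\<close>

definition minor_gradient :: "'a::field \<Rightarrow> 'a ^ 6 \<Rightarrow> 'a ^ 5 \<Rightarrow> 'a ^ 5 \<Rightarrow> 'a ^ 5"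
  where "minor_gradient d a b u = vector
   [d * (u $ 3 * u $ 5 - (u $ 4)\<^sup>2) + a $ 1 * u $ 3 + a $ 2 * u $ 4 + a $ 3 * u $ 5 + b $ 1,
    d * (2 * u $ 3 * u $ 4 - 2 * u $ 2 * u $ 5) - 2 * a $ 1 * u $ 2 - a $ 2 * u $ 3
      + a $ 4 * u $ 4 + a $ 5 * u $ 5 + b $ 2,
    d * (u $ 1 * u $ 5 + 2 * u $ 2 * u $ 4 - 3 * (u $ 3)\<^sup>2) + a $ 1 * u $ 1 - a $ 2 * u $ 2
      - 2 * a $ 3 * u $ 3 - 2 * a $ 4 * u $ 3 - a $ 5 * u $ 4 + a $ 6 * u $ 5 + b $ 3,
    d * (2 * u $ 2 * u $ 3 - 2 * u $ 1 * u $ 4) + a $ 2 * u $ 1 + a $ 4 * u $ 2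
      - a $ 5 * u $ 3 - 2 * a $ 6 * u $ 4 + b $ 4,
    d * (u $ 1 * u $ 3 - (u $ 2)\<^sup>2) + a $ 3 * u $ 1 + a $ 5 * u $ 2 + a $ 6 * u $ 3 + b $ 5]"

lemma det_hankel:
  "det (hankel u) = (u $ 1 * u $ 3 - (u $ 2)\<^sup>2) * u $ 5
     - u $ 1 * (u $ 4)\<^sup>2 + 2 * u $ 2 * u $ 3 * u $ 4 - (u $ 3) ^ 3"
  for u :: "'a::field ^ 5"
  by (simp add: hankel_def det_3) algebra

lemma has_derivative_minor_combination:
  fixes d c :: "'a::real_normed_field" and x :: "'b::real_normed_vector \<Rightarrow> 'a ^ 5"
  assumes "(x has_derivative x') (at t)"
  shows "((\<lambda>t. minor_combination d a b c (x t)) has_derivative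
     (\<lambda>v. minor_gradient d a b (x t) $ 1 * x' v $ 1 + minor_gradient d a b (x t) $ 2 * x' v $ 2
        + minor_gradient d a b (x t) $ 3 * x' v $ 3 + minor_gradient d a b (x t) $ 4 * x' v $ 4
        + minor_gradient d a b (x t) $ 5 * x' v $ 5)) (at t)"
  unfolding minor_combination_def det_hankel power2_eq_square power3_eq_cube
  by (rule derivative_eq_intros assms refl)+
     (simp add: fun_eq_iff minor_gradient_def, simp add: algebra_simps power2_eq_square)

text \<open>
  With \<open>h\<^sub>i\<close> the partial derivatives of \<open>h\<close>, this is the polynomial
  \<open>h\<^sub>1 + h\<^sub>2 l + h\<^sub>3 l\<^sup>2 + h\<^sub>4 l\<^sup>3 + h\<^sub>5 l\<^sup>4\<close> in \<open>l\<close>, i.e. the derivative of \<open>h\<close> in the direction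
  \<open>(1, l, l\<^sup>2, l\<^sup>3, l\<^sup>4)\<close>. Up to the factor \<open>h\<^sub>5\<close> it is the characteristic polynomial of the
  Jacobian matrix of the system.
\<close>

definition characteristic_poly :: "'a::field \<Rightarrow> 'a ^ 6 \<Rightarrow> 'a ^ 5 \<Rightarrow> 'a ^ 5 \<Rightarrow> 'a poly"
  where "characteristic_poly d a b u =
    [:minor_gradient d a b u $ 1, minor_gradient d a b u $ 2, minor_gradient d a b u $ 3,
      minor_gradient d a b u $ 4, minor_gradient d a b u $ 5:]"

text \<open>
  The point \<open>(1, l, l\<^sup>2, l\<^sup>3, l\<^sup>4)\<close> corresponds to a Hankel matrix of rank one. Adding multiples of a
  matrix of rank one changes every minor in an affine way, so the second derivative of \<open>h\<close> in this
  direction vanishes. This is the reason for linear degeneracy.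
\<close>

lemma characteristic_poly_along_curve:
  fixes d :: "'a::real_normed_field"
  assumes "\<And>i. ((\<lambda>t. x t $ i) has_field_derivative x' $ i) (at t)"
    and "x' $ 1 = s" "x' $ 2 = s * l" "x' $ 3 = s * l ^ 2" "x' $ 4 = s * l ^ 3" "x' $ 5 = s * l ^ 4"
  shows "((\<lambda>t. poly (characteristic_poly d a b (x t)) l) has_field_derivative 0) (at t)"
  unfolding minor_gradient_def vector_5 characteristic_poly_def poly_pCons poly_0
  by (rule derivative_eq_intros assms(1) refl)+
     (simp add: assms algebra_simps power2_eq_square power3_eq_cube power4_eq_xxxx)

section \<open>The implicit function\<close>

lemma append5_nth [simp]:
  "append5 u s $ 1 = u $ 1" "append5 u s $ 2 = u $ 2" "append5 u s $ 3 = u $ 3"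
  "append5 u s $ 4 = u $ 4" "append5 u s $ 5 = s"
  by (simp_all add: append5_def)

text \<open>Every minor of the Hankel matrix is affine in \<open>u\<^sub>5\<close>.\<close>

lemma minor_combination_append5:
  "minor_combination d a b c (append5 u s) =
     minor_gradient d a b (append5 u 0) $ 5 * s + minor_combination d a b c (append5 u 0)"
  by (simp add: minor_combination_def det_hankel minor_gradient_def algebra_simps)

lemma minor_gradient_5_append5:
  "minor_gradient d a b (append5 u s) $ 5 = minor_gradient d a b (append5 u 0) $ 5"
  by (simp add: minor_gradient_def)

lemma deriv_minor_combination_append5:
  fixes d :: "'a::real_normed_field"
  shows "deriv (\<lambda>s. minor_combination d a b c (append5 u s)) t = minor_gradient d a b (append5 u 0) $ 5"
  by (rule DERIV_imp_deriv, subst minor_combination_append5)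
     (auto intro!: derivative_eq_intros)

text \<open>The gradient \<open>g\<^sub>i = - h\<^sub>i / h\<^sub>5\<close> of the function \<open>g\<close> defined by \<open>h(u\<^sub>1,\<dots>,u\<^sub>4,g) = 0\<close>.\<close>

definition implicit_gradient :: "'a::field \<Rightarrow> 'a ^ 6 \<Rightarrow> 'a ^ 5 \<Rightarrow> 'a ^ 5 \<Rightarrow> 'a ^ 4"
  where "implicit_gradient d a b u = vector
   [- minor_gradient d a b u $ 1 / minor_gradient d a b u $ 5,
    - minor_gradient d a b u $ 2 / minor_gradient d a b u $ 5,
    - minor_gradient d a b u $ 3 / minor_gradient d a b u $ 5,
    - minor_gradient d a b u $ 4 / minor_gradient d a b u $ 5]"

lemma has_derivative_implicit:
  fixes d c :: "'a::{real_normed_field, euclidean_space}"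
  assumes g: "solves_for_u5 (minor_combination d a b c) U g" and u: "u \<in> U"
  defines "q \<equiv> implicit_gradient d a b (append5 u (g u))"
  shows "(g has_derivative (\<lambda>v. \<Sum>i\<in>UNIV. q $ i * v $ i)) (at u)"
proof -
  let ?P = "\<lambda>u. minor_gradient d a b (append5 u 0) $ 5"
  let ?Q = "\<lambda>u. minor_combination d a b c (append5 u 0)"
  have U: "open U" and h: "\<And>u. u \<in> U \<Longrightarrow> minor_combination d a b c (append5 u (g u)) = 0"
    and P: "\<And>u. u \<in> U \<Longrightarrow> ?P u \<noteq> 0"
    using g by (auto simp: solves_for_u5_def deriv_minor_combination_append5)
  have g_eq: "g u = - ?Q u / ?P u" if "u \<in> U" for u
    using h[OF that] P[OF that]
    by (subst (asm) minor_combination_append5)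
      (metis add_eq_0_iff2 mult.commute nonzero_eq_divide_eq)
  have app: "((\<lambda>u. append5 u (k u)) has_derivative (\<lambda>v. append5 v (k' v))) (at u)"
    if "(k has_derivative k') (at u)" for k k' and u :: "'a ^ 4"
  proof (rule has_derivative_vecI)
    fix i :: 5
    show "((\<lambda>x. append5 x (k x) $ i) has_derivative (\<lambda>v. append5 v (k' v) $ i)) (at u)"
      using exhaust_5[of i] that by (elim disjE) (simp_all add: has_derivative_vec_nth)
  qed
  \<comment> \<open>Since \<open>g\<close> is a rational function, it is differentiable; the value of its derivative then
    follows by differentiating \<open>h = 0\<close>.\<close>
  have "\<exists>P'. (?P has_derivative P') (at u)"
    unfolding minor_gradient_def append5_nth vector_5 power2_eq_square
    by (rule exI, (rule has_derivative_add has_derivative_diff has_derivative_mult has_derivative_vec_nth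
        has_derivative_const has_derivative_ident)+)
  then obtain P' where P': "(?P has_derivative P') (at u)" ..
  have "(?Q has_derivative (\<lambda>v.
      minor_gradient d a b (append5 u 0) $ 1 * append5 v 0 $ 1 + minor_gradient d a b (append5 u 0) $ 2 * append5 v 0 $ 2 +
      minor_gradient d a b (append5 u 0) $ 3 * append5 v 0 $ 3 + minor_gradient d a b (append5 u 0) $ 4 * append5 v 0 $ 4 +
      minor_gradient d a b (append5 u 0) $ 5 * append5 v 0 $ 5)) (at u)"
    by (rule has_derivative_minor_combination[OF app[OF has_derivative_const]])
  from has_derivative_divide[OF has_derivative_minus[OF this] P' P[OF u]]
  obtain g' where "((\<lambda>u. - ?Q u / ?P u) has_derivative g') (at u)" by blast
  then have g': "(g has_derivative g') (at u)"
    by (rule has_derivative_transform_within_open[OF _ U u]) (simp add: g_eq)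
  from has_derivative_minor_combination[OF app[OF g'], where d = d and a = a and b = b and c = c]
  have "((\<lambda>u. minor_combination d a b c (append5 u (g u))) has_derivative (\<lambda>v.
      minor_gradient d a b (append5 u (g u)) $ 1 * v $ 1 + minor_gradient d a b (append5 u (g u)) $ 2 * v $ 2 +
      minor_gradient d a b (append5 u (g u)) $ 3 * v $ 3 + minor_gradient d a b (append5 u (g u)) $ 4 * v $ 4 +
      ?P u * g' v)) (at u)" (is "(_ has_derivative ?D) _")
    by (simp add: minor_gradient_5_append5[of d a b u "g u"])
  then have "((\<lambda>u. 0) has_derivative ?D) (at u)"
    by (rule has_derivative_transform_within_open[OF _ U u]) (rule h)
  from has_derivative_unique[OF this has_derivative_const]
  have "?D = (\<lambda>v. 0)" .
  then have "?D v = 0" for v by meson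
  then have "g' = (\<lambda>v. \<Sum>i\<in>UNIV. q $ i * v $ i)"
    using P[OF u] minor_gradient_5_append5[of d a b u "g u"]
    by (simp add: fun_eq_iff q_def sum_4 implicit_gradient_def divide_simps) (simp add: algebra_simps eq_neg_iff_add_eq_0)
  with g' show ?thesis by simp
qed

section \<open>The Jacobian matrix of the system\<close>

text \<open>The companion matrix with last row \<open>q\<close>.\<close>

definition companion :: "'a::field ^ 4 \<Rightarrow> 'a ^ 4 ^ 4"
  where "companion q = vector [axis 2 1, axis 3 1, axis 4 1, q]"

lemma companion_mult_vec:
  "companion q *v v = vector [v $ 2, v $ 3, v $ 4, \<Sum>i\<in>UNIV. q $ i * v $ i]"
  by (simp add: vec_eq_iff forall_4 companion_def matrix_vector_mult_def sum_4 axis_def)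

lemma has_derivative_shift_flux:
  assumes "(g has_derivative (\<lambda>v. \<Sum>i\<in>UNIV. q $ i * v $ i)) (at u)"
  shows "(shift_flux g has_derivative (*v) (companion q)) (at u)"
proof (rule has_derivative_vecI)
  fix i :: 4
  show "((\<lambda>x. shift_flux g x $ i) has_derivative (\<lambda>v. (companion q *v v) $ i)) (at u)"
    using exhaust_4[of i] assms unfolding shift_flux_def companion_mult_vec
    by (elim disjE) (simp_all add: has_derivative_vec_nth)
qed

lemma companion_eigenvector_iff:
  "companion q *v r = l *s r \<longleftrightarrow>
    r $ 2 = r $ 1 * l \<and> r $ 3 = r $ 1 * l\<^sup>2 \<and> r $ 4 = r $ 1 * l ^ 3 \<and>
    r $ 1 * (q $ 1 + q $ 2 * l + q $ 3 * l\<^sup>2 + q $ 4 * l ^ 3) = r $ 1 * l ^ 4"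
  by (auto simp: vec_eq_iff forall_4 companion_mult_vec sum_4 algebra_simps power_numeral_reduce)

lemma eigenvalues_companion:
  "eigenvalues (companion q) = {l. q $ 1 + q $ 2 * l + q $ 3 * l\<^sup>2 + q $ 4 * l ^ 3 = l ^ 4}"
proof (intro set_eqI iffI)
  fix l assume "l \<in> eigenvalues (companion q)"
  then obtain r where "r \<noteq> 0" "companion q *v r = l *s r" by (auto simp: eigenvalues_def)
  then show "l \<in> {l. q $ 1 + q $ 2 * l + q $ 3 * l\<^sup>2 + q $ 4 * l ^ 3 = l ^ 4}"
    unfolding companion_eigenvector_iff by (cases "r $ 1 = 0") (auto simp: vec_eq_iff[of r 0] forall_4)
next
  fix l assume "l \<in> {l. q $ 1 + q $ 2 * l + q $ 3 * l\<^sup>2 + q $ 4 * l ^ 3 = l ^ 4}"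
  then have "companion q *v vector [1, l, l\<^sup>2, l ^ 3] = l *s vector [1, l, l\<^sup>2, l ^ 3]"
    by (simp add: companion_eigenvector_iff)
  moreover have "vector [1, l, l\<^sup>2, l ^ 3] \<noteq> (0 :: 'a ^ 4)"
    by (simp add: vec_eq_iff forall_4)
  ultimately show "l \<in> eigenvalues (companion q)" unfolding eigenvalues_def by blast
qed

lemma implicit_gradient_root_iff:
  assumes "minor_gradient d a b u $ 5 \<noteq> 0"
  defines "q \<equiv> implicit_gradient d a b u"
  shows "q $ 1 + q $ 2 * l + q $ 3 * l\<^sup>2 + q $ 4 * l ^ 3 = l ^ 4 \<longleftrightarrow>
    poly (characteristic_poly d a b u) l = 0"
proof -
  have "- minor_gradient d a b u $ 5 * (q $ 1 + q $ 2 * l + q $ 3 * l\<^sup>2 + q $ 4 * l ^ 3 - l ^ 4) =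
      poly (characteristic_poly d a b u) l"
    using assms(1) unfolding q_def implicit_gradient_def characteristic_poly_def vector_4
    by (simp add: right_diff_distrib distrib_left) (simp add: algebra_simps power_numeral_reduce)
  then show ?thesis using assms(1) by (metis eq_iff_diff_eq_0 mult_eq_0_iff neg_equal_0_iff_equal)
qed

section \<open>Roots of polynomials\<close>

lemma poly_simple_root:
  fixes p :: "'a::{idom, ring_char_0} poly"
  assumes "card {x. poly p x = 0} = degree p" and "p \<noteq> 0" and "poly p l = 0"
  shows "poly (pderiv p) l \<noteq> 0"
proof
  assume "poly (pderiv p) l = 0"
  obtain q where q: "p = [:- l, 1:] * q" using assms(3) by (auto simp: poly_eq_0_iff_dvd elim: dvdE)
  then have "q \<noteq> 0" using assms(2) by auto
  with q have deg: "degree p = Suc (degree q)" by (subst q, subst degree_mult_eq) auto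
  have "poly q l = 0" using \<open>poly (pderiv p) l = 0\<close> by (subst (asm) q) (simp add: pderiv_mult pderiv_pCons del: mult_pCons_left)
  then have "{x. poly p x = 0} = {x. poly q x = 0}" by (auto simp: q)
  moreover have "card {x. poly q x = 0} \<le> degree q"
    using \<open>q \<noteq> 0\<close> by (intro card_poly_roots_bound)
  ultimately show False using assms(1) deg by simp
qed

lemma poly_synthetic_div_eq_pderiv: "poly (synthetic_div p z) z = poly (pderiv p) z"
  for z :: "'a::idom"
proof -
  have "pderiv p = pderiv ([:- z, 1:] * synthetic_div p z + [:poly p z:])"
    by (simp only: synthetic_div_correct')
  also have "poly \<dots> z = poly (synthetic_div p z) z"
    by (simp add: pderiv_add pderiv_mult pderiv_pCons del: mult_pCons_left)
  finally show ?thesis by simp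
qed

lemma isCont_synthetic_div_characteristic_poly:
  fixes d :: "'a::real_normed_field"
  assumes "\<And>i. isCont (\<lambda>t. x t $ i) t" "isCont y t"
  shows "isCont (\<lambda>t. poly (synthetic_div (characteristic_poly d a b (x t)) z) (y t)) t"
  unfolding minor_gradient_def vector_5 characteristic_poly_def synthetic_div_pCons synthetic_div_0
    poly_pCons poly_0
  by (intro assms continuous_const continuous_add continuous_diff continuous_mult continuous_power)

text \<open>
  In the application \<open>\<phi> s = F s (y t)\<close> for a family \<open>F s\<close> of polynomials, \<open>y s\<close> is a root of \<open>F s\<close>,
  and \<open>G s\<close> is the difference quotient of \<open>F s\<close> between \<open>y s\<close> and \<open>y t\<close>. Only continuity of \<open>y\<close> is
  needed, in order that \<open>G\<close> be continuous.
\<close>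

lemma DERIV_zero_of_factor:
  fixes y :: "'a::real_normed_field \<Rightarrow> 'a"
  assumes \<phi>: "(\<phi> has_field_derivative 0) (at t)"
    and G: "isCont G t" "G t \<noteq> 0"
    and S: "open S" "t \<in> S"
    and eq: "\<And>s. s \<in> S \<Longrightarrow> (y s - y t) * G s + \<phi> s = 0"
  shows "(y has_field_derivative 0) (at t)"
proof -
  have \<phi>t: "\<phi> t = 0" using eq[OF S(2)] by simp
  have "(\<lambda>s. (\<phi> s - \<phi> t) / (s - t)) \<midarrow>t\<rightarrow> 0"
    using \<phi> by (simp add: has_field_derivative_iff)
  moreover have "G \<midarrow>t\<rightarrow> G t" using G(1) by (simp add: isCont_def)
  ultimately have "(\<lambda>s. - ((\<phi> s - \<phi> t) / (s - t)) / G s) \<midarrow>t\<rightarrow> - 0 / G t"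
    using G(2) by (intro tendsto_divide tendsto_minus)
  moreover have "\<forall>\<^sub>F s in at t. - ((\<phi> s - \<phi> t) / (s - t)) / G s = (y s - y t) / (s - t)"
  proof -
    have "\<forall>\<^sub>F s in at t. G s \<noteq> 0"
      using \<open>G \<midarrow>t\<rightarrow> G t\<close> G(2) by (rule tendsto_imp_eventually_ne)
    moreover have "\<forall>\<^sub>F s in at t. s \<in> S"
      using S by (rule eventually_at_in_open')
    ultimately show ?thesis
    proof eventually_elim
      case (elim s)
      have "\<phi> s = - ((y s - y t) * G s)" using eq[OF elim(2)] by (simp add: eq_neg_iff_add_eq_0 add.commute)
      then show ?case using elim(1) \<phi>t by simp
    qed
  qed
  ultimately have "(\<lambda>s. (y s - y t) / (s - t)) \<midarrow>t\<rightarrow> - 0 / G t"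
    by (rule Lim_transform_eventually)
  then show ?thesis by (simp add: has_field_derivative_iff)
qed

section \<open>The system is a T-system\<close>

lemma continuous_on_vecI:
  fixes f :: "'a::topological_space \<Rightarrow> 'b::topological_space ^ 'n"
  assumes "\<And>i. continuous_on U (\<lambda>u. f u $ i)"
  shows "continuous_on U f"
  using continuous_on_vec_lambda[where f = "\<lambda>i u. f u $ i", OF assms] by simp

lemma T_system_shift_flux:
  fixes d c :: "'a::{real_normed_field, euclidean_space}"
  assumes g: "solves_for_u5 (minor_combination d a b c) U g"
    and hyp: "strictly_hyperbolic U (shift_flux g)"
  shows "T_system U (shift_flux g)"
proof -
  let ?p = "\<lambda>u. characteristic_poly d a b (append5 u (g u))"
  define q where "q u = implicit_gradient d a b (append5 u (g u))" for u
  have U: "open U" and g_cont: "continuous_on U g"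
    using g by (auto simp: solves_for_u5_def)
  have h5: "minor_gradient d a b (append5 u (g u)) $ 5 \<noteq> 0" if "u \<in> U" for u
    using g that minor_gradient_5_append5[of d a b u "g u"]
    by (auto simp: solves_for_u5_def deriv_minor_combination_append5)
  have dg: "(g has_derivative (\<lambda>v. \<Sum>i\<in>UNIV. q u $ i * v $ i)) (at u)" if "u \<in> U" for u
    unfolding q_def using g that by (rule has_derivative_implicit)
  have df: "(shift_flux g has_derivative (*v) (companion (q u))) (at u)" if "u \<in> U" for u
    using dg[OF that] by (rule has_derivative_shift_flux)
  have J: "jacobian_matrix (shift_flux g) u = companion (q u)" if "u \<in> U" for u
    using df[OF that] by (rule jacobian_matrix_eqI)
  have "continuous_on U (\<lambda>u. companion (q u))"
  proof (rule continuous_on_vecI)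
    have "continuous_on U q"
    proof (rule continuous_on_vecI)
      have grad: "continuous_on U (\<lambda>u. minor_gradient d a b (append5 u (g u)) $ i)" for i
        using exhaust_5[of i] unfolding minor_gradient_def append5_nth
        by (elim disjE) (simp_all, (intro continuous_intros g_cont)+)
      fix i :: 4
      show "continuous_on U (\<lambda>u. q u $ i)"
        using exhaust_4[of i] unfolding q_def implicit_gradient_def
        by (elim disjE) (simp_all, (intro continuous_on_divide continuous_on_minus grad ballI h5, assumption)+)
    qed
    fix i :: 4
    show "continuous_on U (\<lambda>u. companion (q u) $ i)"
      using exhaust_4[of i] \<open>continuous_on U q\<close> unfolding companion_def by (elim disjE) simp_all
  qed
  then have J_cont: "continuous_on U (jacobian_matrix (shift_flux g))"
    by (rule continuous_on_eq) (simp add: J)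
  have simple: "poly (pderiv (?p u)) l \<noteq> 0" if u: "u \<in> U" and l: "poly (?p u) l = 0" for u l
  proof (rule poly_simple_root)
    have "eigenvalues (jacobian_matrix (shift_flux g) u) = {x. poly (?p u) x = 0}"
      using implicit_gradient_root_iff[OF h5[OF u]] by (simp add: J[OF u] eigenvalues_companion q_def)
    moreover have "degree (?p u) = 4" using h5[OF u] by (simp add: characteristic_poly_def)
    moreover have "card (eigenvalues (jacobian_matrix (shift_flux g) u)) = 4"
      using hyp u by (simp add: strictly_hyperbolic_def)
    ultimately show "card {x. poly (?p u) x = 0} = degree (?p u)" by simp
    show "?p u \<noteq> 0" using h5[OF u] by (auto simp: characteristic_poly_def)
  qed (rule l)
  have key: "(l \<circ> \<gamma>) constant_on S \<and> (\<exists>p v. v \<noteq> 0 \<and> \<gamma> ` S \<subseteq> range (\<lambda>t. p + t *s v))"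
    if curve: "rarefaction_curve U (shift_flux g) l S \<gamma>" for l S and \<gamma> :: "'a \<Rightarrow> 'a ^ 4"
  proof -
    obtain V r where VU: "V \<subseteq> U" and ev: "eigenvector_field (shift_flux g) V l r"
      and ic: "integral_curve r V S \<gamma>"
      using curve by (auto simp: rarefaction_curve_def)
    have S: "open S" "connected S" and \<gamma>V: "\<And>t. t \<in> S \<Longrightarrow> \<gamma> t \<in> V"
      and d\<gamma>: "\<And>t i. t \<in> S \<Longrightarrow> ((\<lambda>s. \<gamma> s $ i) has_field_derivative r (\<gamma> t) $ i) (at t)"
      using ic by (auto simp: integral_curve_def)
    have \<gamma>U: "\<gamma> t \<in> U" if "t \<in> S" for t using \<gamma>V[OF that] VU by auto
    have r0: "r u \<noteq> 0" and ev_eq: "companion (q u) *v r u = l u *s r u" if "u \<in> V" for u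
      using ev that J[of u, symmetric] VU by (simp_all add: eigenvector_field_def subset_iff)
    have r: "r u $ 2 = r u $ 1 * l u" "r u $ 3 = r u $ 1 * (l u)\<^sup>2" "r u $ 4 = r u $ 1 * l u ^ 3"
      and r_root: "r u $ 1 * (q u $ 1 + q u $ 2 * l u + q u $ 3 * (l u)\<^sup>2 + q u $ 4 * l u ^ 3) = r u $ 1 * l u ^ 4"
      if "u \<in> V" for u
      using ev_eq[OF that] unfolding companion_eigenvector_iff by blast+
    have r1: "r u $ 1 \<noteq> 0" if "u \<in> V" for u
      using r0[OF that] r[OF that] by (auto simp: vec_eq_iff forall_4)
    have root: "poly (?p u) (l u) = 0" if "u \<in> V" for u
      using r_root[OF that] r1[OF that] implicit_gradient_root_iff[OF h5, of u "l u"] that VU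
      by (auto simp: q_def)
    define x where "x t = append5 (\<gamma> t) (g (\<gamma> t))" for t
    define x' where "x' t = append5 (r (\<gamma> t)) (r (\<gamma> t) $ 1 * l (\<gamma> t) ^ 4)" for t
    \<comment> \<open>The lift of the curve to the hypersurface \<open>h = 0\<close> moves in the direction of a Hankel matrix
      of rank one.\<close>
    have dx: "((\<lambda>t. x t $ i) has_field_derivative x' t $ i) (at t)" if t: "t \<in> S" for i t
    proof -
      have "(\<gamma> has_derivative (\<lambda>h. h *s r (\<gamma> t))) (at t)"
        using d\<gamma>[OF t] by (intro has_derivative_vecI) (simp add: has_field_derivative_def mult_commute_abs)
      note d = has_derivative_compose[OF this dg[OF \<gamma>U[OF t]]]
      have "((\<lambda>s. g (\<gamma> s)) has_field_derivative (\<Sum>i\<in>UNIV. q (\<gamma> t) $ i * r (\<gamma> t) $ i)) (at t)"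
        unfolding has_field_derivative_def
        by (rule has_derivative_eq_rhs[OF d]) (simp add: fun_eq_iff sum_distrib_left mult_ac)
      also have "(\<Sum>i\<in>UNIV. q (\<gamma> t) $ i * r (\<gamma> t) $ i) = r (\<gamma> t) $ 1 * l (\<gamma> t) ^ 4"
        using r_root[OF \<gamma>V[OF t]] r[OF \<gamma>V[OF t]] by (simp add: sum_4 algebra_simps)
      finally show ?thesis
        using exhaust_5[of i] d\<gamma>[OF t] unfolding x_def x'_def by (elim disjE) simp_all
    qed
    have x_cont: "isCont (\<lambda>t. x t $ i) t" if "t \<in> S" for i t
      using dx[OF that] by (rule DERIV_isCont)
    have r_cont: "continuous_on V r" using ev by (simp add: eigenvector_field_def)
    have \<gamma>_cont: "continuous_on S \<gamma>"
      using d\<gamma> by (intro continuous_on_vecI continuous_at_imp_continuous_on) (blast intro: DERIV_isCont)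
    \<comment> \<open>The eigenvalue inherits its continuity from the eigenvector field, being the quotient
      of the first two components.\<close>
    have "continuous_on S (\<lambda>t. r (\<gamma> t))"
      by (rule continuous_on_compose2[OF r_cont \<gamma>_cont]) (use \<gamma>V in blast)
    then have "continuous_on S (\<lambda>t. r (\<gamma> t) $ 2 / r (\<gamma> t) $ 1)"
      using r1 \<gamma>V by (intro continuous_on_divide continuous_on_component) auto
    then have "continuous_on S (l \<circ> \<gamma>)"
      by (rule continuous_on_eq) (simp add: r \<gamma>V r1)
    then have l_cont: "isCont (l \<circ> \<gamma>) t" if "t \<in> S" for t
      using that continuous_on_eq_continuous_at[OF S(1)] by blast
    have "((l \<circ> \<gamma>) has_field_derivative 0) (at t)" if t: "t \<in> S" for t
    proof (rule DERIV_zero_of_factor[where S = S])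
      let ?G = "\<lambda>s. poly (synthetic_div (characteristic_poly d a b (x s)) (l (\<gamma> t))) ((l \<circ> \<gamma>) s)"
      show "((\<lambda>s. poly (characteristic_poly d a b (x s)) (l (\<gamma> t))) has_field_derivative 0) (at t)"
        by (rule characteristic_poly_along_curve[OF dx[OF t], where s = "r (\<gamma> t) $ 1"])
          (simp_all add: x'_def r \<gamma>V t)
      show "isCont ?G t"
        by (intro isCont_synthetic_div_characteristic_poly x_cont l_cont t)
      show "?G t \<noteq> 0"
        using simple[OF \<gamma>U[OF t] root[OF \<gamma>V[OF t]]] by (simp add: poly_synthetic_div_eq_pderiv x_def)
      show "((l \<circ> \<gamma>) s - (l \<circ> \<gamma>) t) * ?G s + poly (characteristic_poly d a b (x s)) (l (\<gamma> t)) = 0"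
        if "s \<in> S" for s
      proof -
        let ?p = "characteristic_poly d a b (x s)"
        have "poly ?p (l (\<gamma> s)) = 0" using root[OF \<gamma>V[OF that]] by (simp add: x_def)
        then have "poly ([:- l (\<gamma> t), 1:] * synthetic_div ?p (l (\<gamma> t)) + [:poly ?p (l (\<gamma> t)):]) (l (\<gamma> s)) = 0"
          by (simp only: synthetic_div_correct')
        then show ?thesis by (simp add: algebra_simps)
      qed
    qed (use S t in auto)
    from has_field_derivative_0_imp_constant_on[OF this S(2,1)]
    have const: "(l \<circ> \<gamma>) constant_on S" .
    then obtain k where k: "\<And>t. t \<in> S \<Longrightarrow> l (\<gamma> t) = k" by (auto simp: constant_on_def)
    define v :: "'a ^ 4" where "v = vector [1, k, k\<^sup>2, k ^ 3]"
    have v1: "v $ 1 = 1" by (simp add: v_def)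
    have rv: "r (\<gamma> t) $ i = r (\<gamma> t) $ 1 * v $ i" if "t \<in> S" for t i
      using exhaust_4[of i] r[OF \<gamma>V[OF that]] k[OF that] unfolding v_def by (elim disjE) simp_all
    have "((\<lambda>t. \<gamma> t $ i - \<gamma> t $ 1 * v $ i) has_field_derivative 0) (at t)" if "t \<in> S" for t i
      by (rule derivative_eq_intros d\<gamma>[OF that] refl)+ (simp add: rv[OF that, of i])
    from has_field_derivative_0_imp_constant_on[OF this S(2,1)]
    have "\<forall>i. \<exists>c. \<forall>t\<in>S. \<gamma> t $ i - \<gamma> t $ 1 * v $ i = c" by (simp add: constant_on_def)
    then obtain p where p: "\<And>i t. t \<in> S \<Longrightarrow> \<gamma> t $ i - \<gamma> t $ 1 * v $ i = p i" by metis
    have "\<gamma> t = (\<chi> i. p i) + \<gamma> t $ 1 *s v" if "t \<in> S" for t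
      by (simp add: vec_eq_iff p[OF that, symmetric])
    then have "\<gamma> ` S \<subseteq> range (\<lambda>t. (\<chi> i. p i) + t *s v)" by blast
    moreover have "v \<noteq> 0" using v1 by (metis zero_index zero_neq_one)
    ultimately show ?thesis using const by blast
  qed
  show ?thesis
    unfolding T_system_def linearly_degenerate_def rarefaction_curves_are_lines_def
    using U J J_cont df hyp key by simp
qed

section \<open>Linear functionals and dimension\<close>

lemma functional_separating_subspace:
  fixes S :: "('a::field ^ 'n) set"
  assumes S: "vec.subspace S" and w: "w \<notin> S"
  obtains k where "\<And>s. s \<in> S \<Longrightarrow> (\<Sum>i\<in>UNIV. k i * s $ i) = 0" and "(\<Sum>i\<in>UNIV. k i * w $ i) \<noteq> 0"
proof -
  obtain B where B: "B \<subseteq> S" "vec.independent B" "S \<subseteq> vec.span B"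
    by (rule vec.basis_exists)
  have "w \<notin> vec.span B" using w B(1) S vec.span_minimal by blast
  then have "vec.independent (insert w B)" using B(2) by (rule vec.independent_insertI)
  from vec.linear_independent_extend[OF this, of "\<lambda>x. if x = w then w else 0"]
  obtain f :: "'a ^ 'n \<Rightarrow> 'a ^ 'n" where f: "Vector_Spaces.linear (*s) (*s) f"
    and "\<forall>x\<in>insert w B. f x = (if x = w then w else 0)" by blast
  then have fw: "f w = w" and fB: "\<forall>x\<in>B. x \<noteq> w \<longrightarrow> f x = 0" by simp_all
  interpret f: Vector_Spaces.linear "(*s)" "(*s)" f by (rule f)
  have f0: "f s = 0" if "s \<in> S" for s
  proof (rule f.eq_0_on_span)
    show "s \<in> vec.span B" using that B(3) by auto
    show "f x = 0" if "x \<in> B" for x using that fB w B(1) by auto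
  qed
  have "w \<noteq> 0" using w vec.subspace_0[OF S] by auto
  then obtain i where i: "w $ i \<noteq> 0" by (auto simp: vec_eq_iff)
  have fc: "(\<Sum>j\<in>UNIV. f (axis j 1) $ i * x $ j) = f x $ i" for x
    using linear_componentwise[OF f, of x i] by (simp add: mult.commute)
  show thesis
    by (rule that[of "\<lambda>j. f (axis j 1) $ i"]) (simp_all add: fc f0 fw i)
qed

text \<open>
  If no nontrivial linear relation between the coordinates in \<open>I\<close> holds on \<open>S\<close>, then \<open>S\<close> projects
  onto the coordinate space of \<open>I\<close>.
\<close>

lemma card_le_dim_if_coordinates_independent:
  fixes S :: "('a::field ^ 'n) set"
  assumes S: "vec.subspace S"
    and indep: "\<And>k. \<lbrakk>\<And>s. s \<in> S \<Longrightarrow> (\<Sum>i\<in>I. k i * s $ i) = 0\<rbrakk> \<Longrightarrow> \<forall>i\<in>I. k i = 0"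
  shows "card I \<le> vec.dim S"
proof -
  define \<pi> :: "'a ^ 'n \<Rightarrow> 'a ^ 'n" where "\<pi> x = (\<chi> i. if i \<in> I then x $ i else 0)" for x
  have lin: "Vector_Spaces.linear (*s) (*s) \<pi>"
    by unfold_locales (auto simp: \<pi>_def vec_eq_iff)
  interpret \<pi>: Vector_Spaces.linear "(*s)" "(*s)" \<pi> by (rule lin)
  have sub: "vec.subspace (\<pi> ` S)" using S by (rule \<pi>.subspace_image)
  have "axis j 1 \<in> \<pi> ` S" if j: "j \<in> I" for j
  proof (rule ccontr)
    assume "axis j 1 \<notin> \<pi> ` S"
    then obtain k where k: "\<And>s. s \<in> \<pi> ` S \<Longrightarrow> (\<Sum>i\<in>UNIV. k i * s $ i) = 0"
      and kj: "(\<Sum>i\<in>UNIV. k i * axis j 1 $ i) \<noteq> (0 :: 'a)"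
      using functional_separating_subspace[OF sub] by blast
    have "(\<Sum>i\<in>I. k i * s $ i) = 0" if "s \<in> S" for s
    proof -
      have "(\<Sum>i\<in>UNIV. k i * \<pi> s $ i) = (\<Sum>i\<in>I. k i * s $ i)"
        by (rule sum.mono_neutral_cong_right) (auto simp: \<pi>_def)
      then show ?thesis using k[of "\<pi> s"] that by simp
    qed
    then have "k j = 0" using indep j by blast
    with kj show False by (simp add: axis_def if_distrib[where f = "(*) _"] cong: if_cong)
  qed
  then have "(\<lambda>j. axis j 1) ` I \<subseteq> \<pi> ` S" by auto
  moreover have "vec.independent ((\<lambda>j. axis j (1::'a)) ` I :: ('a ^ 'n) set)"
    by (rule vec.independent_mono[OF independent_cart_basis]) (auto simp: cart_basis_def)
  ultimately have "card ((\<lambda>j. axis j (1::'a)) ` I :: ('a ^ 'n) set) \<le> vec.dim (\<pi> ` S)"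
    by (rule vec.independent_card_le_dim)
  moreover have "card ((\<lambda>j. axis j (1::'a)) ` I :: ('a ^ 'n) set) = card I"
    by (intro card_image inj_onI) (simp add: axis_eq_axis)
  moreover have "vec.dim (\<pi> ` S) \<le> vec.dim S" using lin by (rule vec.dim_image_le)
  ultimately show ?thesis by simp
qed

section \<open>Polynomial maps\<close>

lemma polynomial_map_diff:
  assumes "polynomial_map p" "polynomial_map q"
  shows "polynomial_map (\<lambda>x. p x - q x)"
  using polynomial_map.add[OF assms(1) polynomial_map.mult[OF polynomial_map.const[of "-1"] assms(2)]] by simp

lemma polynomial_map_power: "polynomial_map p \<Longrightarrow> polynomial_map (\<lambda>x. p x ^ n)"
  by (induction n) (simp_all add: polynomial_map.const polynomial_map.mult)

lemma polynomial_map_on_line: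
  assumes "polynomial_map p"
  shows "\<exists>r. \<forall>t. p (x + t *s v) = poly r t"
  using assms
proof induction
  case (const c)
  have "\<forall>t. c = poly [:c:] t" by simp
  then show ?case by blast
next
  case (coordinate i)
  have "\<forall>t. (x + t *s v) $ i = poly [:x $ i, v $ i:] t" by simp
  then show ?case by blast
next
  case (add p q)
  then obtain r s where "\<forall>t. p (x + t *s v) = poly r t" "\<forall>t. q (x + t *s v) = poly s t" by blast
  then have "\<forall>t. p (x + t *s v) + q (x + t *s v) = poly (r + s) t" by simp
  then show ?case by blast
next
  case (mult p q)
  then obtain r s where "\<forall>t. p (x + t *s v) = poly r t" "\<forall>t. q (x + t *s v) = poly s t" by blast
  then have "\<forall>t. p (x + t *s v) * q (x + t *s v) = poly (r * s) t" by simp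
  then show ?case by blast
qed

text \<open>
  Polynomial maps over a field of characteristic 0 form an integral domain: restrict both factors
  to the line through \<open>x\<close> and \<open>y\<close>.
\<close>

lemma polynomial_map_mult_eq_0:
  fixes p q :: "'a::field_char_0 ^ 'n \<Rightarrow> 'a"
  assumes p: "polynomial_map p" and q: "polynomial_map q" and pq: "\<And>x. p x * q x = 0"
    and x: "p x \<noteq> 0"
  shows "q y = 0"
proof (rule ccontr)
  assume y: "q y \<noteq> 0"
  obtain r s where r: "\<And>t. p (x + t *s (y - x)) = poly r t" and s: "\<And>t. q (x + t *s (y - x)) = poly s t"
    using polynomial_map_on_line[OF p] polynomial_map_on_line[OF q] by metis
  have "poly (r * s) t = 0" for t using pq[of "x + t *s (y - x)"] by (metis poly_mult r s)
  then have "r * s = 0" using poly_all_0_iff_0 by blast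
  moreover have "r \<noteq> 0" using r[of 0] x by auto
  moreover have "s \<noteq> 0" using s[of 1] y by auto
  ultimately show False by simp
qed

section \<open>Independence of the minors on the hypersurface\<close>

text \<open>
  A combination of minors of size at most 2 that vanishes on the cubic hypersurface is trivial.
  Write the two combinations as \<open>P u\<^sub>5 + Q\<close> and \<open>A u\<^sub>5 + B\<close>, with \<open>P\<close>, \<open>Q\<close>, \<open>A\<close>, \<open>B\<close> polynomials in
  \<open>u\<^sub>1,\<dots>,u\<^sub>4\<close>. Eliminating \<open>u\<^sub>5\<close> gives \<open>A Q = B P\<close>; here \<open>P\<close> and \<open>A\<close> do not involve \<open>u\<^sub>4\<close>, so the
  coefficients of \<open>u\<^sub>4\<^sup>2\<close> can be compared, which forces \<open>A = 0\<close> and then \<open>B = 0\<close>.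
\<close>

lemma hankel_minors_independent_on_hypersurface:
  fixes d c :: "'a::field_char_0"
  assumes d: "d \<noteq> 0"
    and zero: "\<And>u. minor_combination d a b c u = 0 \<Longrightarrow> minor_combination 0 a' b' c' u = 0"
  shows "a' = 0 \<and> b' = 0 \<and> c' = 0"
proof -
  define P Q A B :: "'a ^ 4 \<Rightarrow> 'a" where
    "P u = minor_gradient d a b (append5 u 0) $ 5" and
    "Q u = minor_combination d a b c (append5 u 0)" and
    "A u = minor_gradient 0 a' b' (append5 u 0) $ 5" and
    "B u = minor_combination 0 a' b' c' (append5 u 0)" for u
  note defs = P_def Q_def A_def B_def minor_combination_def det_hankel minor_gradient_def
  have poly: "polynomial_map P" "polynomial_map Q" "polynomial_map A" "polynomial_map B"
    unfolding defs[abs_def] append5_nth vector_5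
    by (intro polynomial_map.intros polynomial_map_diff polynomial_map_power)+
  have P_mult: "P u * (A u * Q u - B u * P u) = 0" for u
  proof (cases "P u = 0")
    case False
    define s where "s = - Q u / P u"
    have "minor_combination d a b c (append5 u s) = 0"
      by (subst minor_combination_append5) (use False in \<open>simp add: s_def P_def Q_def\<close>)
    then have "minor_combination 0 a' b' c' (append5 u s) = 0" by (rule zero)
    then have "A u * s + B u = 0"
      by (subst (asm) minor_combination_append5) (simp add: A_def B_def)
    then have "A u * Q u - B u * P u = 0" using False by (simp add: s_def field_simps)
    then show ?thesis by simp
  qed simp
  \<comment> \<open>The coefficient of \<open>u\<^sub>2\<^sup>2\<close> in \<open>P\<close> is \<open>- d\<close>.\<close>
  have P_nz: "\<exists>u. u $ 1 = x \<and> P u \<noteq> 0" for x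
  proof -
    let ?u = "\<lambda>y. vector [x, y, 0, 0] :: 'a ^ 4"
    have "P (?u 1) + P (?u (-1)) - 2 * P (?u 0) = - 2 * d"
      by (simp add: defs)
    then have "P (?u 1) \<noteq> 0 \<or> P (?u (-1)) \<noteq> 0 \<or> P (?u 0) \<noteq> 0" using d by auto
    then show ?thesis by (metis vector_4(1))
  qed
  have eq: "A u * Q u - B u * P u = 0" for u
  proof -
    obtain v where "P v \<noteq> 0" using P_nz by blast
    then show ?thesis
      by (intro polynomial_map_mult_eq_0[where q = "\<lambda>u. A u * Q u - B u * P u", OF poly(1) _ P_mult])
        (intro polynomial_map_diff polynomial_map.mult poly)
  qed
  have eq2: "A u * (d * u $ 1 + a $ 6) = a' $ 6 * P u" for u
  proof -
    let ?u = "\<lambda>y. vector [u $ 1, u $ 2, u $ 3, y] :: 'a ^ 4"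
    \<comment> \<open>Second differences in \<open>u\<^sub>4\<close> pick out the coefficients of \<open>u\<^sub>4\<^sup>2\<close>.\<close>
    have A: "A (?u y) = A u" and P: "P (?u y) = P u" for y by (simp_all add: defs)
    have Q: "Q (?u 1) + Q (?u (- 1)) - 2 * Q (?u 0) = - 2 * (d * u $ 1 + a $ 6)"
      by (simp add: defs algebra_simps)
    have B: "B (?u 1) + B (?u (- 1)) - 2 * B (?u 0) = - 2 * a' $ 6"
      by (simp add: defs algebra_simps)
    have "A u * (Q (?u 1) + Q (?u (- 1)) - 2 * Q (?u 0)) = (B (?u 1) + B (?u (- 1)) - 2 * B (?u 0)) * P u"
      using eq[of "?u 0"] eq[of "?u 1"] eq[of "?u (- 1)"] unfolding A P by (simp add: algebra_simps)
    then have "- 2 * (A u * (d * u $ 1 + a $ 6)) = - 2 * (a' $ 6 * P u)"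
      unfolding Q B by (simp only: mult_ac)
    then show ?thesis by simp
  qed
  have a6: "a' $ 6 = 0"
  proof -
    obtain u where u: "u $ 1 = - a $ 6 / d" "P u \<noteq> 0" using P_nz by blast
    then show ?thesis using eq2[of u] d by simp
  qed
  have A0: "A u = 0" for u
  proof (rule polynomial_map_mult_eq_0)
    show "polynomial_map (\<lambda>u :: 'a ^ 4. d * u $ 1 + a $ 6)" by (intro polynomial_map.intros)
    show "polynomial_map A" by (rule poly)
    show "(d * u $ 1 + a $ 6) * A u = 0" for u using eq2[of u] a6 by (simp add: mult.commute)
    show "d * (vector [(1 - a $ 6) / d, 0, 0, 0] :: 'a ^ 4) $ 1 + a $ 6 \<noteq> 0" using d by simp
  qed
  have B0: "B u = 0" for u
  proof -
    obtain v where "P v \<noteq> 0" using P_nz by blast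
    moreover have "P u * B u = 0" for u using eq[of u] A0[of u] by auto
    ultimately show ?thesis using polynomial_map_mult_eq_0 poly by blast
  qed
  have *: "A (vector [x, y, z, w]) = 0" "B (vector [x, y, z, w]) = 0" for x y z w
    by (rule A0, rule B0)
  have b5: "b' $ 5 = 0" using *(1)[of 0 0 0 0] by (simp add: defs)
  have a3: "a' $ 3 = 0" using *(1)[of 1 0 0 0] b5 by (simp add: defs)
  have a5: "a' $ 5 = 0" using *(1)[of 0 1 0 0] b5 by (simp add: defs)
  have c: "c' = 0" using *(2)[of 0 0 0 0] by (simp add: defs)
  have b1: "b' $ 1 = 0" using *(2)[of 1 0 0 0] c by (simp add: defs)
  have b4: "b' $ 4 = 0" using *(2)[of 0 0 0 1] c a6 by (simp add: defs)
  have a1': "b' $ 2 = a' $ 1" using *(2)[of 0 1 0 0] c by (simp add: defs)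
  have "- a' $ 1 = b' $ 2" using *(2)[of 0 "-1" 0 0] c by (simp add: defs)
  with a1' have b2: "b' $ 2 = 0" and a1: "a' $ 1 = 0" by (simp_all add: neg_eq_iff_add_eq_0 flip: mult_2)
  have a2: "a' $ 2 = 0" using *(2)[of 1 0 0 1] c b1 b4 a6 by (simp add: defs)
  have a4: "a' $ 4 = 0" using *(2)[of 0 1 0 1] c b2 b4 a1 a6 by (simp add: defs)
  have b3: "b' $ 3 = 0" using *(2)[of 0 0 1 0] c a3 a4 by (simp add: defs)
  have "(6 :: 6) = 0" by simp
  then have "a' $ 0 = 0" using a6 by metis
  then have "a' = 0" using a1 a2 a3 a4 a5 by (simp add: vec_eq_iff forall_6)
  moreover have "b' = 0" using b1 b2 b3 b4 b5 by (simp add: vec_eq_iff forall_5)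
  ultimately show ?thesis using c by simp
qed

section \<open>The congruence lies in no linear congruence\<close>

text \<open>
  The points of the line \<open>congruence_line u\<close> with \<open>(Y\<^sub>0, Y\<^sub>5) = (1, 0)\<close> and \<open>(0, 1)\<close>. The last entry
  of the list is \<open>Y\<^sub>0\<close>.
\<close>

definition line_point0 :: "'a::field ^ 5 \<Rightarrow> 'a ^ 6"
  where "line_point0 u = vector [u $ 1, u $ 2, u $ 3, u $ 4, 0, 1]"

definition line_point5 :: "'a::field ^ 5 \<Rightarrow> 'a ^ 6"
  where "line_point5 u = vector [- u $ 2, - u $ 3, - u $ 4, - u $ 5, 1, 0]"

lemma congruence_line_in_projective_lines: "congruence_line u \<in> projective_lines"
proof -
  let ?x = "line_point0 u" and ?y = "line_point5 u"
  have "vec.subspace (congruence_line u)"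
    unfolding vec.subspace_def congruence_line_def by auto (simp_all add: algebra_simps)
  moreover have "vec.dim (congruence_line u) = 2"
  proof (rule vec.dim_unique)
    show "{?x, ?y} \<subseteq> congruence_line u"
      by (simp add: congruence_line_def line_point0_def line_point5_def)
    show "congruence_line u \<subseteq> vec.span {?x, ?y}"
    proof
      fix Y assume "Y \<in> congruence_line u"
      then have "Y = Y $ 0 *s ?x + Y $ 5 *s ?y"
        by (simp add: congruence_line_def line_point0_def line_point5_def vec_eq_iff forall_6)
      then show "Y \<in> vec.span {?x, ?y}"
        by (metis insertI1 insertI2 vec.span_add vec.span_base vec.span_scale)
    qed
    have x: "?x $ 0 = 1" "?x $ 5 = 0" and y: "?y $ 0 = 0" "?y $ 5 = 1"
      by (simp_all add: line_point0_def line_point5_def)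
    have "?x \<noteq> k *s ?y" for k
      using x y by (metis mult_zero_right vector_smult_component zero_neq_one)
    moreover have "?y \<noteq> 0" using y by (metis zero_index zero_neq_one)
    ultimately show "vec.independent {?x, ?y}"
      by (auto simp: vec.independent_insert vec.span_singleton)
    have "?x \<noteq> ?y" using x y by (metis zero_neq_one)
    then show "card {?x, ?y} = 2" by simp
  qed
  ultimately show ?thesis by (simp add: projective_lines_def)
qed

lemma congruence_line_in_congruence_of_lines:
  assumes "h u = 0"
  shows "congruence_line u \<in> congruence_of_lines h"
proof -
  let ?B = "{{L \<in> projective_lines. \<exists>x\<in>L. \<exists>y\<in>L. p (wedge x y) \<noteq> 0} | p. polynomial_map p}
    :: ('a ^ 6) set set set"
  have "{L \<in> projective_lines. \<exists>x\<in>L. \<exists>y\<in>L. (\<lambda>_ :: 'a ^ (6 \<times> 6). 1 :: 'a) (wedge x y) \<noteq> 0} \<in> ?B"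
    by (rule CollectI, rule exI[of _ "\<lambda>_. 1"]) (simp add: polynomial_map.const)
  moreover have "L \<in> {L \<in> projective_lines. \<exists>x\<in>L. \<exists>y\<in>L. (1 :: 'a) \<noteq> 0}"
    if "L \<in> projective_lines" for L :: "('a ^ 6) set"
    using that vec.subspace_0[of L] by (auto simp: projective_lines_def)
  ultimately have "projective_lines \<subseteq> \<Union>?B" by (meson UnionI subsetI)
  then have "projective_lines \<subseteq> topspace (zariski :: ('a ^ 6) set topology)"
    unfolding zariski_def topology_generated_by_topspace .
  then have "{congruence_line u | u. h u = 0} \<subseteq> topspace zariski"
    using congruence_line_in_projective_lines by blast
  from closure_of_subset[OF this] show ?thesis
    using assms by (auto simp: congruence_of_lines_def)
qed

text \<open>
  Up to linear combinations, the Pluecker coordinates of \<open>congruence_line u\<close> are \<open>1\<close>, the five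
  \<open>u\<^sub>i\<close> and the six minors of size 2. In particular \<open>p\<^sub>1\<^sub>4\<close> is \<open>u\<^sub>2 u\<^sub>4 - u\<^sub>1 u\<^sub>5\<close>, the difference of
  the fourth and the third minor. The remaining three coordinates \<open>p\<^sub>2\<^sub>5\<close>, \<open>p\<^sub>3\<^sub>5\<close>, \<open>p\<^sub>4\<^sub>5\<close> repeat
  \<open>- p\<^sub>0\<^sub>1\<close>, \<open>- p\<^sub>0\<^sub>2\<close>, \<open>- p\<^sub>0\<^sub>3\<close>.
\<close>

lemma wedge_in_subspace_imp_dim:
  fixes d c :: "'a::field_char_0" and \<Lambda> :: "('a ^ (6 \<times> 6)) set"
  assumes d: "d \<noteq> 0" and \<Lambda>: "vec.subspace \<Lambda>"
    and mem: "\<And>u. minor_combination d a b c u = 0 \<Longrightarrow> wedge (line_point0 u) (line_point5 u) \<in> \<Lambda>"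
  shows "12 \<le> vec.dim \<Lambda>"
proof -
  define I :: "(6 \<times> 6) set" where
    "I = {(0, 5), (0, 1), (0, 2), (0, 3), (0, 4), (1, 5), (1, 2), (1, 3), (1, 4), (2, 3), (2, 4), (3, 4)}"
  have "card I \<le> vec.dim \<Lambda>"
  proof (rule card_le_dim_if_coordinates_independent[OF \<Lambda>])
    fix k :: "6 \<times> 6 \<Rightarrow> 'a"
    assume k: "\<And>s. s \<in> \<Lambda> \<Longrightarrow> (\<Sum>i\<in>I. k i * s $ i) = 0"
    define a' :: "'a ^ 6" where
      "a' = vector [- k (1, 2), - k (1, 3), - k (1, 4), k (1, 4) - k (2, 3), - k (2, 4), - k (3, 4)]"
    define b' :: "'a ^ 5" where
      "b' = vector [k (1, 5), - k (0, 1), - k (0, 2), - k (0, 3), - k (0, 4)]"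
    have "minor_combination 0 a' b' (k (0, 5)) u = 0" if u: "minor_combination d a b c u = 0" for u
    proof -
      have "(\<Sum>i\<in>I. k i * wedge (line_point0 u) (line_point5 u) $ i) = minor_combination 0 a' b' (k (0, 5)) u"
        by (simp add: I_def minor_combination_def a'_def b'_def wedge_def line_point0_def line_point5_def
            algebra_simps power2_eq_square)
      then show ?thesis using k[OF mem[OF u]] by simp
    qed
    from hankel_minors_independent_on_hypersurface[OF d this]
    have *: "a' = 0" "b' = 0" "k (0, 5) = 0" by auto
    have "a' $ i = 0" "b' $ j = 0" for i j using * by simp_all
    note this(1)[of 1] this(1)[of 2] this(1)[of 3] this(1)[of 4] this(1)[of 5] this(1)[of 0]
      this(2)[of 1] this(2)[of 2] this(2)[of 3] this(2)[of 4] this(2)[of 5]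
    then show "\<forall>i\<in>I. k i = 0"
      using *(3) by (simp add: a'_def b'_def I_def)
  qed
  also have "card I = 12" by (simp add: I_def)
  finally show ?thesis .
qed

lemma congruence_not_in_linear_congruence:
  fixes d c :: "'a::field_char_0"
  assumes d: "d \<noteq> 0"
  shows "\<not> (\<exists>X. linear_congruence X \<and> congruence_of_lines (minor_combination d a b c) \<subseteq> X)"
proof
  assume "\<exists>X. linear_congruence X \<and> congruence_of_lines (minor_combination d a b c) \<subseteq> X"
  then obtain \<Lambda> :: "('a ^ (6 \<times> 6)) set" where \<Lambda>: "vec.subspace \<Lambda>" "vec.dim \<Lambda> = 11"
    and sub: "congruence_of_lines (minor_combination d a b c) \<subseteq> linear_section \<Lambda>"
    by (auto simp: linear_congruence_def)
  have "wedge (line_point0 u) (line_point5 u) \<in> \<Lambda>" if "minor_combination d a b c u = 0" for u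
  proof -
    have "congruence_line u \<in> linear_section \<Lambda>"
      using congruence_line_in_congruence_of_lines[of "minor_combination d a b c", OF that] sub by blast
    moreover have "line_point0 u \<in> congruence_line u" "line_point5 u \<in> congruence_line u"
      by (simp_all add: congruence_line_def line_point0_def line_point5_def)
    ultimately show ?thesis by (auto simp: linear_section_def)
  qed
  from wedge_in_subspace_imp_dim[OF d \<Lambda>(1) this] \<Lambda>(2) show False by simp
qed

theorem corollary18:
  fixes d c :: "'a::{real_normed_field, euclidean_space}"
    and a :: "'a ^ 6" and b :: "'a ^ 5"
  defines "h \<equiv> minor_combination d a b c"
  assumes "d \<noteq> 0"
  shows "(\<forall>U g. solves_for_u5 h U g \<and> strictly_hyperbolic U (shift_flux g)
            \<longrightarrow> T_system U (shift_flux g))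
       \<and> \<not> (\<exists>X. linear_congruence X \<and> congruence_of_lines h \<subseteq> X)"
  unfolding h_def
  using T_system_shift_flux congruence_not_in_linear_congruence[OF \<open>d \<noteq> 0\<close>] by blast

end
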